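(* Let $A$ and $B$ be compact sets in $\mathbb{R}^2$ which contain $0$ and such that $\dim(A)=\dim(B)=2$. Suppose that $$x\in \textup{conv}(A+B)\cap[A+\textup{conv}(B)]^c\cap[\textup{conv}(A)+B]^c.$$ Then there exist $a_1,a_2\in A$ and $b_1,b_2\in B$ such that $|a_1-a_2|\leq 2d(A)$, $|b_1-b_2|\leq 2d(B)$, and $x\in [a_1,a_2]+[b_1,b_2]$. That is, $x$ belongs to a parallelogram with side lengths at most $2d(A)$ and $2d(B)$ respectively, and vertex set in the sumset $A+B$.
   Context: For a compact set $A\subseteq\mathbb{R}^n$, the Hausdorff distance from $A$ to its convex hull is $d(A):=\sup_{a\in\textup{conv}(A)}\inf_{x\in A}|x-a|$, where $|\cdot|$ is the Euclidean norm. $\dim(A)$ is the dimension of the affine hull of $A$. $A+B=\{a+b: a\in A,\ b\in B\}$ is the Minkowski sum, $[p,q]$ is the closed line segment between $p$ and $q$, and $S^c$ denotes the complement of $S$ in $\mathbb{R}^2$. *)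

theory Defs
  imports "HOL-Analysis.Analysis" "HOL-Library.Set_Algebras"
begin

text \<open>The Minkowski sum of two sets is the operation \<open>+\<close> on sets from \<open>Set_Algebras\<close>.\<close>

text \<open>Hausdorff distance from a set to its convex hull. The suprema and infima are those of the reals,
  so the value is the intended one only for nonempty bounded \<open>A\<close>.\<close>

definition hull_dist :: "'a::euclidean_space set \<Rightarrow> real" where
  "hull_dist A = (SUP a\<in>convex hull A. INF x\<in>A. norm (x - a))"

end

theory Submission
  imports Defs
begin

text \<open>
  Pass to \<open>K = conv A\<close> and \<open>L = x - conv B\<close>, which meet, while \<open>A\<close> misses \<open>L\<close> and \<open>x - B\<close> misses \<open>K\<close>.
  If a segment \<open>S\<close> with endpoints outside \<open>K\<close> meets \<open>K\<close>, then the line through \<open>S\<close> meets \<open>K\<close> only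
  within \<open>S\<close>. If moreover \<open>S\<close> misses \<open>A\<close>, this line splits \<open>A\<close> into two compact parts, whose closed
  \<open>d(A)\<close>-neighbourhoods cover the connected set \<open>K\<close>; a point in both neighbourhoods yields points of
  \<open>A\<close> on either side of the line at distance at most \<open>2 d(A)\<close>, and the segment joining them crosses
  \<open>S\<close>. As \<open>K\<close> meets \<open>L\<close> but is not contained in it, Caratheodory's theorem gives a triangle with vertices
  in \<open>x - B\<close> whose boundary meets \<open>K\<close>; so some side of it does. Crossing this side by
  a short segment between points of \<open>A\<close>, and crossing the latter in turn by a short segment between
  points of \<open>x - B\<close>, gives the parallelogram.
\<close>

text \<open>Compactness enters twice: \<open>A\<close> has a point nearest to \<open>p\<close>, and
  the hull is bounded, so that the supremum in \<open>hull_dist\<close> is a genuine upper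
  bound.\<close>

lemma hull_dist_attained:
  fixes A :: "'a::euclidean_space set"
  assumes "compact A" "p \<in> convex hull A"
  obtains y where "y \<in> A" "norm (y - p) \<le> hull_dist A"
proof -
  have ne: "A \<noteq> {}" using assms(2) by auto
  have bdd_inf: "bdd_below ((\<lambda>x. norm (x - a)) ` A)" for a
    by (rule bdd_belowI[of _ 0]) auto
  obtain y where y: "y \<in> A" "\<And>z. z \<in> A \<Longrightarrow> dist p y \<le> dist p z"
    using distance_attains_inf[OF compact_imp_closed[OF assms(1)] ne] by metis
  obtain z0 where z0: "z0 \<in> A" using ne by auto
  obtain C where C: "\<And>a. a \<in> convex hull A \<Longrightarrow> norm a \<le> C"
    using bounded_convex_hull[OF compact_imp_bounded[OF assms(1)]] unfolding bounded_iff by blast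
  have "bdd_above ((\<lambda>a. INF x\<in>A. norm (x - a)) ` (convex hull A))"
  proof (rule bdd_aboveI2)
    fix a assume "a \<in> convex hull A"
    then have "norm (z0 - a) \<le> norm z0 + C"
      using norm_triangle_ineq4[of z0 a] C[of a] by linarith
    then show "(INF x\<in>A. norm (x - a)) \<le> norm z0 + C"
      using cINF_lower[OF bdd_inf z0, of a] by linarith
  qed
  then have "(INF x\<in>A. norm (x - p)) \<le> hull_dist A"
    unfolding hull_dist_def by (rule cSUP_upper[OF assms(2)])
  moreover have "norm (y - p) \<le> (INF x\<in>A. norm (x - p))"
    using y(2) ne by (intro cINF_greatest) (auto simp: dist_norm norm_minus_commute)
  ultimately show thesis using that y(1) by force
qed

lemma close_points_across_hyperplane:
  fixes A :: "'a::euclidean_space set"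
  assumes "compact A"
    and miss: "\<And>z. z \<in> A \<Longrightarrow> w \<bullet> z \<noteq> c"
    and "p \<in> convex hull A" "w \<bullet> p = c"
  obtains a1 a2 where "a1 \<in> A" "a2 \<in> A" "w \<bullet> a1 < c" "w \<bullet> a2 > c"
    "norm (a1 - a2) \<le> 2 * hull_dist A"
proof -
  let ?d = "hull_dist A"
  define A1 where "A1 = A \<inter> {z. w \<bullet> z \<le> c}"
  define A2 where "A2 = A \<inter> {z. w \<bullet> z \<ge> c}"
  \<comment> \<open>The closed neighbourhood of radius \<open>?d\<close>, written as a sum with a
    ball so that it is compact, hence closed, for compact \<open>S\<close>.\<close>
  define N where "N S = {u + v | u v. u \<in> S \<and> v \<in> cball 0 ?d}" for S :: "'a set"
  have cl: "closed (N A1)" "closed (N A2)"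
    unfolding N_def A1_def A2_def
    by (intro compact_imp_closed compact_sums compact_Int_closed assms(1) closed_halfspace_le
        closed_halfspace_ge compact_cball)+
  have near: "q \<in> N S" if "u \<in> S" "norm (u - q) \<le> ?d" for u q S
    unfolding N_def using that
    by (intro CollectI exI[of _ u] exI[of _ "q - u"]) (auto simp: norm_minus_commute)
  have nearD: "\<exists>u\<in>S. norm (u - q) \<le> ?d" if "q \<in> N S" for q S
    using that unfolding N_def by force
  have cover: "convex hull A \<subseteq> N A1 \<union> N A2"
  proof
    fix q assume "q \<in> convex hull A"
    then obtain y where "y \<in> A" "norm (y - q) \<le> ?d"
      using hull_dist_attained[OF assms(1)] by metis
    then show "q \<in> N A1 \<union> N A2"
      using near[of y A1 q] near[of y A2 q] unfolding A1_def A2_def by fastforce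
  qed
  have d0: "?d \<ge> 0"
    using hull_dist_attained[OF assms(1,3)] norm_ge_zero order_trans by metis
  \<comment> \<open>Both parts are nonempty: otherwise \<open>A\<close>, and with it its hull, lies
    in an open half-space that excludes \<open>p\<close>.\<close>
  have "\<exists>y\<in>A. w \<bullet> y \<le> c"
  proof (rule ccontr)
    assume "\<not> ?thesis"
    then have "convex hull A \<subseteq> {z. w \<bullet> z > c}"
      by (intro hull_minimal convex_halfspace_gt) auto
    then show False using assms by auto
  qed
  then obtain y1 where y1: "y1 \<in> A1" unfolding A1_def by auto
  have "\<exists>y\<in>A. w \<bullet> y \<ge> c"
  proof (rule ccontr)
    assume "\<not> ?thesis"
    then have "convex hull A \<subseteq> {z. w \<bullet> z < c}"
      by (intro hull_minimal convex_halfspace_lt) auto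
    then show False using assms by auto
  qed
  then obtain y2 where y2: "y2 \<in> A2" unfolding A2_def by auto
  have "y1 \<in> N A1 \<inter> convex hull A" "y2 \<in> N A2 \<inter> convex hull A"
    using y1 y2 near[of y1 A1 y1] near[of y2 A2 y2] d0
    by (auto simp: A1_def A2_def hull_inc)
  moreover have "connected (convex hull A)"
    by (simp add: convex_connected)
  ultimately obtain q where "q \<in> N A1" "q \<in> N A2"
    using cl cover unfolding connected_closed by blast
  then obtain a1 a2 where a: "a1 \<in> A1" "norm (a1 - q) \<le> ?d" "a2 \<in> A2" "norm (a2 - q) \<le> ?d"
    using nearD by metis
  show thesis
  proof (rule that)
    show "a1 \<in> A" "a2 \<in> A" using a by (auto simp: A1_def A2_def)
    then show "w \<bullet> a1 < c" "w \<bullet> a2 > c"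
      using a miss[of a1] miss[of a2] by (auto simp: A1_def A2_def)
    show "norm (a1 - a2) \<le> 2 * ?d"
      using norm_triangle_ineq4[of "a1 - q" "a2 - q"] a by simp
  qed
qed

lemma line_equation_plane:
  fixes b1 b2 :: "real^2"
  assumes "b1 \<noteq> b2"
  obtains w where "w \<bullet> b1 = w \<bullet> b2" "\<And>z. w \<bullet> z = w \<bullet> b1 \<Longrightarrow> \<exists>t. z = b1 + t *\<^sub>R (b2 - b1)"
proof -
  define v where "v = b2 - b1"
  \<comment> \<open>The direction \<open>v\<close> turned by a quarter turn, a normal of the
    line.\<close>
  define w :: "real^2" where "w = vector [- (v $ 2), v $ 1]"
  have v: "v $ 1 \<noteq> 0 \<or> v $ 2 \<noteq> 0"
    using assms unfolding v_def by (auto simp: vec_eq_iff forall_2)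
  have dot: "w \<bullet> u = v $ 1 * u $ 2 - v $ 2 * u $ 1" for u
    by (simp add: w_def inner_vec_def sum_2)
  show thesis
  proof (rule that[of w])
    show "w \<bullet> b1 = w \<bullet> b2"
      by (simp add: dot) (simp add: v_def algebra_simps)
  next
    fix z assume "w \<bullet> z = w \<bullet> b1"
    then have e: "v $ 1 * (z $ 2 - b1 $ 2) = v $ 2 * (z $ 1 - b1 $ 1)"
      by (simp add: dot algebra_simps)
    show "\<exists>t. z = b1 + t *\<^sub>R (b2 - b1)"
    proof (cases "v $ 1 = 0")
      case True
      then have "z $ 1 = b1 $ 1" "v $ 2 \<noteq> 0" using v e by auto
      with True show ?thesis
        by (intro exI[of _ "(z $ 2 - b1 $ 2) / v $ 2"])
          (simp add: vec_eq_iff forall_2 flip: v_def)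
    next
      case False
      with e show ?thesis
        by (intro exI[of _ "(z $ 1 - b1 $ 1) / v $ 1"])
          (simp add: vec_eq_iff forall_2 divide_simps flip: v_def, simp add: algebra_simps)
    qed
  qed
qed

text \<open>In the parametrisation \<open>f\<close> of the line, \<open>b1\<close> and
  \<open>b2\<close> sit at 0 and 1 and \<open>p\<close> at some \<open>s\<close> between them. If
  \<open>t\<close> were outside [0,1], then 0 or 1 would lie between \<open>s\<close> and
  \<open>t\<close>, and convexity would put \<open>b1\<close> or \<open>b2\<close> into
  \<open>K\<close>.\<close>

lemma convex_line_section_subset_segment:
  fixes K :: "'a::real_vector set"
  assumes "convex K" "b1 \<notin> K" "b2 \<notin> K" "p \<in> K" "p \<in> closed_segment b1 b2"
    and "b1 + t *\<^sub>R (b2 - b1) \<in> K"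
  shows "b1 + t *\<^sub>R (b2 - b1) \<in> closed_segment b1 b2"
proof -
  define f where "f s = b1 + s *\<^sub>R (b2 - b1)" for s
  obtain s where s: "p = f s" "0 \<le> s" "s \<le> 1"
    using assms(5) unfolding in_segment f_def by (auto simp: algebra_simps)
  have f_seg: "f ((1 - u) * s + u * t) = (1 - u) *\<^sub>R f s + u *\<^sub>R f t" for u
    by (simp add: f_def algebra_simps)
  have K: "f r \<in> K" if "r \<in> closed_segment s t" for r
  proof -
    obtain u where "0 \<le> u" "u \<le> 1" "r = (1 - u) * s + u * t"
      using \<open>r \<in> closed_segment s t\<close> unfolding in_segment by auto
    then show ?thesis
      using assms(1,4,6) s f_seg[of u] unfolding convex_alt by (simp add: f_def)
  qed
  have "f 0 = b1" "f 1 = b2" by (auto simp: f_def)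
  then have "0 \<notin> closed_segment s t" "1 \<notin> closed_segment s t"
    using K assms(2,3) by metis+
  then have "0 \<le> t" "t \<le> 1"
    using s by (auto simp: closed_segment_eq_real_ivl split: if_splits)
  then show ?thesis
    unfolding in_segment by (intro exI[of _ t]) (auto simp: algebra_simps)
qed

lemma short_segment_across_segment:
  fixes A :: "(real^2) set"
  assumes "compact A"
    and out: "b1 \<notin> convex hull A" "b2 \<notin> convex hull A"
    and meet: "p \<in> convex hull A" "p \<in> closed_segment b1 b2"
    and miss: "A \<inter> closed_segment b1 b2 = {}"
  obtains a1 a2 q where "a1 \<in> A" "a2 \<in> A" "norm (a1 - a2) \<le> 2 * hull_dist A"
    "q \<in> closed_segment a1 a2" "q \<in> closed_segment b1 b2"
proof -
  have "b1 \<noteq> b2" using out meet by auto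
  then obtain w where w: "w \<bullet> b1 = w \<bullet> b2"
    "\<And>z. w \<bullet> z = w \<bullet> b1 \<Longrightarrow> \<exists>t. z = b1 + t *\<^sub>R (b2 - b1)"
    using line_equation_plane by blast
  have on_line: "z \<in> closed_segment b1 b2" if "z \<in> convex hull A" "w \<bullet> z = w \<bullet> b1" for z
    using convex_line_section_subset_segment[OF convex_convex_hull out meet] w(2)[OF that(2)] that(1)
    by blast
  have wp: "w \<bullet> p = w \<bullet> b1"
    using meet(2) w(1) unfolding in_segment by (auto simp: inner_add_right simp flip: distrib_right)
  have "w \<bullet> z \<noteq> w \<bullet> b1" if "z \<in> A" for z
    using on_line[of z] that miss by (auto simp: hull_inc)
  then obtain a1 a2 where a: "a1 \<in> A" "a2 \<in> A" "w \<bullet> a1 < w \<bullet> b1" "w \<bullet> a2 > w \<bullet> b1"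
    "norm (a1 - a2) \<le> 2 * hull_dist A"
    using close_points_across_hyperplane[OF assms(1) _ meet(1) wp] by metis
  \<comment> \<open>The crossing point exists by the intermediate value theorem. It lies in the hull
    of \<open>A\<close>, so \<open>on_line\<close> places it on the segment and not merely on the
    line.\<close>
  have "\<exists>q\<in>closed_segment a1 a2. w \<bullet> q = w \<bullet> b1"
    using a by (intro connected_ivt_hyperplane[of _ a1 a2]) auto
  then obtain q where q: "q \<in> closed_segment a1 a2" "w \<bullet> q = w \<bullet> b1" by auto
  have "closed_segment a1 a2 \<subseteq> convex hull A"
    using a by (intro closed_segment_subset) (auto simp: hull_inc)
  then show thesis using that a q on_line by blast
qed

lemma connected_meets_segment_plane:
  fixes B K :: "(real^2) set"
  assumes "connected K" "K \<inter> convex hull B \<noteq> {}" "\<not> K \<subseteq> convex hull B"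
  obtains b1 b2 q where "b1 \<in> B" "b2 \<in> B" "q \<in> closed_segment b1 b2" "q \<in> K"
proof -
  obtain p where p: "p \<in> K" "p \<in> convex hull B" using assms(2) by auto
  then obtain S where S: "finite S" "S \<subseteq> B" "card S \<le> 3" "p \<in> convex hull S"
    unfolding caratheodory[of B] by auto
  \<comment> \<open>Fewer than three points are listed with repetition; the frontier formula below
    also covers such degenerate triangles.\<close>
  obtain a b c where abc: "S = {a, b, c}"
  proof -
    have "S \<noteq> {}" using S by auto
    then have "card S = 1 \<or> card S = 2 \<or> card S = 3" using S(1,3) card_gt_0_iff[of S] by linarith
    then show thesis
      using that by (auto simp: card_1_singleton_iff card_2_iff card_3_iff)
  qed
  have "convex hull S \<subseteq> convex hull B" using S(2) by (rule hull_mono)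
  then have "K \<inter> frontier (convex hull S) \<noteq> {}"
    using assms(1,3) p S(4) by (intro connected_Int_frontier) auto
  moreover have "frontier (convex hull S) = closed_segment a b \<union> closed_segment b c \<union> closed_segment c a"
    unfolding abc by (rule frontier_of_triangle) simp
  ultimately show thesis using that S(2) abc by blast
qed

theorem lemma3p6:
  fixes A B :: "(real^2) set" and x :: "real^2"
  assumes "compact A" and "compact B"
    and "0 \<in> A" and "0 \<in> B"
    and "aff_dim A = 2" and "aff_dim B = 2"
    and "x \<in> convex hull (A + B) \<inter> - (A + convex hull B) \<inter> - (convex hull A + B)"
  shows "\<exists>a1\<in>A. \<exists>a2\<in>A. \<exists>b1\<in>B. \<exists>b2\<in>B.
    norm (a1 - a2) \<le> 2 * hull_dist A \<and> norm (b1 - b2) \<le> 2 * hull_dist B \<and>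
    x \<in> closed_segment a1 a2 + closed_segment b1 b2"
proof -
  \<comment> \<open>The reflection \<open>z\<close> to \<open>x - z\<close> is an affine involution,
    so it maps segments to segments.\<close>
  have flip: "x - q \<in> closed_segment u v" if "q \<in> closed_segment (x - u) (x - v)" for q u v
    using that unfolding in_segment by (force simp: algebra_simps)
  have noA: "x - a \<notin> convex hull B" if "a \<in> A" for a
    using assms(7) set_plus_intro[OF that, of "x - a" "convex hull B"] by auto
  have noB: "x - b \<notin> convex hull A" if "b \<in> B" for b
    using assms(7) set_plus_intro[OF _ that, of "x - b" "convex hull A"] by auto
  have hullA: "closed_segment u v \<subseteq> convex hull A" if "u \<in> A" "v \<in> A" for u v
    using that by (intro closed_segment_subset) (auto simp: hull_inc)
  have hullB: "closed_segment u v \<subseteq> convex hull B" if "u \<in> B" "v \<in> B" for u v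
    using that by (intro closed_segment_subset) (auto simp: hull_inc)
  \<comment> \<open>Reflecting the hull of \<open>A\<close> instead of \<open>B\<close> lets the
    triangle have its vertices in \<open>B\<close> itself.\<close>
  let ?K = "(\<lambda>z. x - z) ` (convex hull A)"
  obtain u v where uv: "u \<in> convex hull A" "v \<in> convex hull B" "x = u + v"
    using assms(7) unfolding convex_hull_set_plus by (auto elim: set_plus_elim)
  have "connected ?K"
    by (intro connected_continuous_image continuous_intros convex_connected convex_convex_hull)
  moreover have "v \<in> ?K \<inter> convex hull B" using uv by (auto simp: image_iff intro: bexI[of _ u])
  \<comment> \<open>The point 0 of \<open>A\<close> witnesses that \<open>?K\<close> is not
    contained in the hull of \<open>B\<close>.\<close>
  moreover have "x - 0 \<in> ?K" "x - 0 \<notin> convex hull B"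
    using noA assms(3) by (blast intro: hull_inc)+
  ultimately obtain b1 b2 q where b: "b1 \<in> B" "b2 \<in> B" "q \<in> closed_segment b1 b2" "q \<in> ?K"
    using connected_meets_segment_plane[of ?K B] by blast
  have "x - q \<in> closed_segment (x - b1) (x - b2)"
    using flip[of q "x - b1" "x - b2"] b by simp
  moreover have "x - q \<in> convex hull A" using b by auto
  moreover have "A \<inter> closed_segment (x - b1) (x - b2) = {}"
    using flip hullB[OF b(1,2)] noA by blast
  ultimately obtain a1 a2 r where a: "a1 \<in> A" "a2 \<in> A" "norm (a1 - a2) \<le> 2 * hull_dist A"
    "r \<in> closed_segment a1 a2" "r \<in> closed_segment (x - b1) (x - b2)"
    using short_segment_across_segment[OF assms(1) noB[OF b(1)] noB[OF b(2)]] by metis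
  \<comment> \<open>The roles are exchanged: after reflection, the segment from
    \<open>x - a1\<close> to \<open>x - a2\<close> has endpoints outside the hull of
    \<open>B\<close>, misses \<open>B\<close>, and meets that hull at \<open>x - r\<close>.\<close>
  have "x - r \<in> closed_segment (x - a1) (x - a2)"
    using flip[of r "x - a1" "x - a2"] a by simp
  moreover have "x - r \<in> convex hull B" using flip[OF a(5)] hullB[OF b(1,2)] by blast
  moreover have "B \<inter> closed_segment (x - a1) (x - a2) = {}"
    using flip hullA[OF a(1,2)] noB by blast
  ultimately obtain c1 c2 s where c: "c1 \<in> B" "c2 \<in> B" "norm (c1 - c2) \<le> 2 * hull_dist B"
    "s \<in> closed_segment c1 c2" "s \<in> closed_segment (x - a1) (x - a2)"
    using short_segment_across_segment[OF assms(2) noA[OF a(1)] noA[OF a(2)]] by metis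
  \<comment> \<open>Split \<open>x\<close> as \<open>(x - s) + s\<close>.\<close>
  have "x \<in> closed_segment a1 a2 + closed_segment c1 c2"
    using set_plus_intro[OF flip[OF c(5)] c(4)] by simp
  then show ?thesis using a c by blast
qed

end
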